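(* Let $(X,\|\cdot\|)$ be a hyper-cylindrical normed space. (i) If $(G,p)$ is a full, well-positioned and infinitesimally rigid bar-joint framework in $(X,\|\cdot\|)$, $G=(V,E)$, then either $G=K_7$ (up to isomorphism) or $|V|\ge8$. (ii) For every $G\in\{K_m: m\ge7\}$ there is a placement $p$ of $G$ in $X$ such that $(G,p)$ is full, well-positioned and infinitesimally rigid in $(X,\|\cdot\|)$.
   Context: A hyper-cylindrical normed space is a real normed space isometrically isomorphic to $(\mathbb{R}^4,\|\cdot\|_{\mathrm{hcyl}})$, where $\|(w,x,y,z)\|_{\mathrm{hcyl}}=\max\{\sqrt{w^2+x^2+y^2},|z|\}$. $K_m$ is the complete graph on $m$ vertices. Frameworks. $G=(V,E)$ is a finite simple graph. A bar-joint framework $(G,p)$ in $X$ is $G$ with a map (placement) $p:V\to X$, $v\mapsto p_v$, such that $p_v\ne p_w$ for all $vw\in E$. A support functional for a unit vector $x_0\in X$ is a linear functional $f:X\to\mathbb{R}$ with $\|f\|\le1$ and $f(x_0)=1$; the norm is smooth at $x\neq0$ if $x/\|x\|$ has exactly one support functional. $(G,p)$ is well-positioned if the norm is smooth at $p_v-p_w$ for every $vw\in E$. A rigid motion of $(X,\|\cdot\|)$ is a family of continuous paths $\{\alpha_x:[-1,1]\to X\}_{x\in X}$ with $\alpha_x(0)=x$, $\alpha_x$ differentiable at $0$, and $\|\alpha_x(t)-\alpha_y(t)\|=\|x-y\|$ for all $x,y\in X$, $t\in[-1,1]$. $\mathcal{T}(X,\|\cdot\|)$ is the space of maps $\eta:X\to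 X$, $\eta(x)=\alpha_x'(0)$. A non-empty set $S\subseteq X$ is full in $(X,\|\cdot\|)$ if the map $\mathcal{T}(X,\|\cdot\|)\to X^S$, $\eta\mapsto(\eta(x))_{x\in S}$, is injective; $(G,p)$ is full if $\{p_v:v\in V\}$ is full. With $f_G:X^V\to\mathbb{R}^E$, $f_G((x_v)_v)=(\|x_v-x_w\|)_{vw\in E}$, an infinitesimal flex of $(G,p)$ is $z\in X^V$ with $\lim_{t\to0}\frac1t(f_G(p+tz)-f_G(p))=0$; it is trivial if $z=\eta\circ p$ for some $\eta\in\mathcal{T}(X,\|\cdot\|)$. $(G,p)$ is infinitesimally rigid if every infinitesimal flex is trivial. *)

theory Defs
  imports "HOL-Analysis.Analysis"
begin

section \<open>Hyper-cylindrical normed spaces\<close>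

definition hcyl_norm :: "real ^ 4 \<Rightarrow> real" where
  "hcyl_norm u = max (sqrt ((u $ 1)\<^sup>2 + (u $ 2)\<^sup>2 + (u $ 3)\<^sup>2)) \<bar>u $ 4\<bar>"

definition hyper_cylindrical :: "'a::real_normed_vector itself \<Rightarrow> bool" where
  "hyper_cylindrical _ \<longleftrightarrow>
     (\<exists>T :: 'a \<Rightarrow> real ^ 4. linear T \<and> bij T \<and> (\<forall>x. hcyl_norm (T x) = norm x))"


section \<open>Finite simple graphs\<close>

text \<open>A graph is a pair of a vertex set and a set of two-element sets of vertices.\<close>

type_synonym 'v graph = "'v set \<times> 'v set set"

abbreviation verts :: "'v graph \<Rightarrow> 'v set" where "verts \<equiv> fst"
abbreviation edges :: "'v graph \<Rightarrow> 'v set set" where "edges \<equiv> snd"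

definition finite_simple_graph :: "'v graph \<Rightarrow> bool" where
  "finite_simple_graph G \<longleftrightarrow> finite (verts G) \<and> (\<forall>e\<in>edges G. e \<subseteq> verts G \<and> card e = 2)"

definition complete_graph :: "nat \<Rightarrow> nat graph" where
  "complete_graph m = ({..<m}, {e. e \<subseteq> {..<m} \<and> card e = 2})"

definition graph_isomorphic :: "'v graph \<Rightarrow> 'w graph \<Rightarrow> bool" where
  "graph_isomorphic G H \<longleftrightarrow>
     (\<exists>f. bij_betw f (verts G) (verts H) \<and> (\<lambda>e. f ` e) ` edges G = edges H)"


section \<open>Smooth points of the norm\<close>

definition support_functional :: "('a::real_normed_vector \<Rightarrow> real) \<Rightarrow> 'a \<Rightarrow> bool" where
  "support_functional f x0 \<longleftrightarrow> bounded_linear f \<and> onorm f \<le> 1 \<and> f x0 = 1"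

definition norm_smooth_at :: "'a::real_normed_vector \<Rightarrow> bool" where
  "norm_smooth_at x \<longleftrightarrow> x \<noteq> 0 \<and> (\<exists>!f. support_functional f (x /\<^sub>R norm x))"


section \<open>Rigid motions and full sets\<close>

text \<open>The paths are total functions of a real parameter; values outside
  \<open>{-1..1}\<close> are irrelevant.\<close>

definition rigid_motion :: "('a::real_normed_vector \<Rightarrow> real \<Rightarrow> 'a) \<Rightarrow> bool" where
  "rigid_motion \<alpha> \<longleftrightarrow>
     (\<forall>x. continuous_on {-1..1} (\<alpha> x) \<and> \<alpha> x 0 = x \<and> \<alpha> x differentiable (at 0)) \<and>
     (\<forall>x y. \<forall>t\<in>{-1..1}. norm (\<alpha> x t - \<alpha> y t) = norm (x - y))"

definition inf_rigid_motions :: "('a::real_normed_vector \<Rightarrow> 'a) set" where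
  "inf_rigid_motions =
     {\<eta>. \<exists>\<alpha>. rigid_motion \<alpha> \<and> (\<forall>x. \<eta> x = vector_derivative (\<alpha> x) (at 0))}"

definition full_set :: "'a::real_normed_vector set \<Rightarrow> bool" where
  "full_set S \<longleftrightarrow> S \<noteq> {} \<and> inj_on (\<lambda>\<eta>. restrict \<eta> S) inf_rigid_motions"


section \<open>Bar-joint frameworks\<close>

text \<open>A placement, and likewise a flex, is a total function on the type of
  vertices of which only the values on \<open>verts G\<close> matter.\<close>

definition framework :: "'v graph \<Rightarrow> ('v \<Rightarrow> 'a::real_normed_vector) \<Rightarrow> bool" where
  "framework G p \<longleftrightarrow>
     finite_simple_graph G \<and> (\<forall>v w. {v, w} \<in> edges G \<longrightarrow> p v \<noteq> p w)"

definition well_positioned :: "'v graph \<Rightarrow> ('v \<Rightarrow> 'a::real_normed_vector) \<Rightarrow> bool" where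
  "well_positioned G p \<longleftrightarrow> (\<forall>v w. {v, w} \<in> edges G \<longrightarrow> norm_smooth_at (p v - p w))"

definition full_framework :: "'v graph \<Rightarrow> ('v \<Rightarrow> 'a::real_normed_vector) \<Rightarrow> bool" where
  "full_framework G p \<longleftrightarrow> full_set (p ` verts G)"

definition rigidity_map ::
    "'v graph \<Rightarrow> ('v \<Rightarrow> 'a::real_normed_vector) \<Rightarrow> 'v set \<Rightarrow> real" where
  "rigidity_map G x =
     (\<lambda>e\<in>edges G. THE d. \<exists>v w. e = {v, w} \<and> d = norm (x v - x w))"

lemma rigidity_map_edge:
  assumes "{v, w} \<in> edges G"
  shows "rigidity_map G x {v, w} = norm (x v - x w)"
proof -
  have "(THE d. \<exists>a b. {v, w} = {a, b} \<and> d = norm (x a - x b)) = norm (x v - x w)"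
    by (rule the_equality) (auto simp: doubleton_eq_iff norm_minus_commute)
  then show ?thesis
    using assms by (simp add: rigidity_map_def)
qed

text \<open>Convergence in the finite-dimensional space of real functions on \<open>edges G\<close> is
  convergence of every coordinate.\<close>

definition infinitesimal_flex ::
    "'v graph \<Rightarrow> ('v \<Rightarrow> 'a::real_normed_vector) \<Rightarrow> ('v \<Rightarrow> 'a) \<Rightarrow> bool" where
  "infinitesimal_flex G p z \<longleftrightarrow>
     (\<forall>e\<in>edges G.
        ((\<lambda>t. (1 / t) * (rigidity_map G (\<lambda>v. p v + t *\<^sub>R z v) e - rigidity_map G p e))
           \<longlongrightarrow> 0) (at 0))"

definition trivial_flex ::
    "'v graph \<Rightarrow> ('v \<Rightarrow> 'a::real_normed_vector) \<Rightarrow> ('v \<Rightarrow> 'a) \<Rightarrow> bool" where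
  "trivial_flex G p z \<longleftrightarrow> (\<exists>\<eta>\<in>inf_rigid_motions. \<forall>v\<in>verts G. z v = \<eta> (p v))"

definition infinitesimally_rigid ::
    "'v graph \<Rightarrow> ('v \<Rightarrow> 'a::real_normed_vector) \<Rightarrow> bool" where
  "infinitesimally_rigid G p \<longleftrightarrow> (\<forall>z. infinitesimal_flex G p z \<longrightarrow> trivial_flex G p z)"

end

theory Submission
  imports Defs
begin

text \<open>
  In coordinates \<open>x = (u, h)\<close> with \<open>u \<in> \<real>\<^sup>3\<close> and \<open>h \<in> \<real>\<close>, the norm is \<open>max \<bar>u\<bar> \<bar>h\<bar>\<close>. It is
  smooth at \<open>x\<close> exactly when \<open>\<bar>u\<bar> \<noteq> \<bar>h\<bar>\<close>, and there an edge is of one of two kinds: if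
  \<open>\<bar>u\<bar> > \<bar>h\<bar>\<close> it imposes on a flex the Euclidean bar condition on the \<open>\<real>\<^sup>3\<close>-components, and
  if \<open>\<bar>h\<bar> > \<bar>u\<bar>\<close> it forces the two ends to have the same vertical velocity
  (\<open>norm_smooth_at_iff\<close>, \<open>infinitesimal_flex_iff\<close>).

  The infinitesimal rigid motions are the maps \<open>(u, h) \<mapsto> (\<omega> \<times> u + b, c)\<close>, a space of
  dimension 7. That nothing else occurs follows from applying the first-order conditions to
  all pairs of points of \<open>X\<close> at once (\<open>inf_rigid_motion_is_motion\<close>); conversely each such
  map is integrated by a rational path of rotations, the Cayley transform
  (\<open>motion_in_inf_rigid_motions\<close>). A set is therefore full exactly when its \<open>\<real>\<^sup>3\<close>-components
  are not collinear.

  For the first claim, a full and infinitesimally rigid framework on \<open>n\<close> vertices has a flex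
  space of dimension 7 inside a space of dimension \<open>4 n\<close>, whence \<open>\<bar>E\<bar> \<ge> 4 n - 7\<close>
  (\<open>edge_count_if_rigid\<close>). Together with \<open>\<bar>E\<bar> \<le> n (n - 1) / 2\<close> this reads
  \<open>(n - 2) (n - 7) \<ge> 0\<close>, and \<open>n \<ge> 3\<close> by fullness; so \<open>n \<ge> 7\<close>, and for \<open>n = 7\<close> all 21 edges
  are present.

  For the second claim the 21 edges of \<open>K\<^sub>7\<close> have to split into 6 edges of vertical kind
  that form a spanning tree, which makes the vertical velocity constant, and 15 edges of
  Euclidean kind that form an isostatic graph in \<open>\<real>\<^sup>3\<close>. The tree is chosen such that its
  complement arises from a triangle by successively joining a new vertex to three old ones;
  rigidity then propagates one vertex at a time (\<open>rotation_field_on_triangle\<close>,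
  \<open>rotation_field_extends\<close>). All further vertices of \<open>K\<^sub>m\<close> are placed on one short vertical
  segment, where each of them has three Euclidean edges in independent directions and one
  vertical edge to the first seven (\<open>infinitesimally_rigid_placement\<close>).
\<close>

section \<open>Homogeneous linear systems\<close>

text \<open>
  For a new equation \<open>j\<close>, first solve the others by some \<open>x\<close> and let \<open>x i \<noteq> 0\<close>; then solve
  them by some \<open>y \<noteq> 0\<close> with \<open>y i = 0\<close>, by dropping the unknown \<open>i\<close>. The two are independent,
  so some combination of them also satisfies equation \<open>j\<close>.
\<close>

lemma homogeneous_system_nontrivial:
  fixes L :: "'j \<Rightarrow> ('i \<Rightarrow> real) \<Rightarrow> real"
  assumes "finite J" and "finite I" and "card J < card I"
    and "\<And>j x y a b. j \<in> J \<Longrightarrow> L j (\<lambda>i. a * x i + b * y i) = a * L j x + b * L j y"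
  shows "\<exists>x. (\<exists>i. x i \<noteq> 0) \<and> (\<forall>i. i \<notin> I \<longrightarrow> x i = 0) \<and> (\<forall>j\<in>J. L j x = 0)"
  using assms
proof (induction J arbitrary: I rule: finite_induct)
  case empty
  then obtain i where "i \<in> I" by fastforce
  then show ?case by (intro exI[of _ "\<lambda>k. if k = i then 1 else 0"]) auto
next
  case (insert j J)
  note lin = insert.prems(3)
  have card: "card J < card (I - {i})" if "i \<in> I" for i
    using insert.prems(1,2) insert.hyps that by simp
  have IH: "\<exists>x. (\<exists>k. x k \<noteq> 0) \<and> (\<forall>k. k \<notin> I - {i} \<longrightarrow> x k = 0) \<and> (\<forall>j\<in>J. L j x = 0)"
    if "i \<in> I" for i
    using insert.prems(1) card[OF that] lin by (intro insert.IH) auto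
  obtain i0 where "i0 \<in> I" using insert.prems(2) by fastforce
  from IH[OF this] obtain x i where x: "x i \<noteq> 0" "\<And>k. k \<notin> I \<Longrightarrow> x k = 0" "\<And>j. j \<in> J \<Longrightarrow> L j x = 0"
    by blast
  have "i \<in> I" using x by blast
  from IH[OF this] obtain y k where y: "y k \<noteq> 0" "\<And>k. k \<notin> I \<Longrightarrow> y k = 0" "y i = 0"
      "\<And>j. j \<in> J \<Longrightarrow> L j y = 0"
    by blast
  show ?case
  proof (cases "L j x = 0")
    case True
    then show ?thesis using x by blast
  next
    case False
    define z where "z = (\<lambda>i. L j y * x i + (- L j x) * y i)"
    have "z i \<noteq> 0 \<or> z k \<noteq> 0" using False x(1) y(1,3) by (auto simp: z_def)
    moreover have "L j' z = 0" if "j' \<in> insert j J" for j'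
      using that x(3) y(4) unfolding z_def by (subst lin) auto
    moreover have "z l = 0" if "l \<notin> I" for l using that x(2) y(2) by (simp add: z_def)
    ultimately show ?thesis by blast
  qed
qed

section \<open>Infinitesimal rotations of Euclidean 3-space\<close>

unbundle no set_product_syntax and cross3_syntax

text \<open>
  The determinant times \<open>x\<close> expands in the dual basis \<open>b \<times> c\<close>, \<open>c \<times> a\<close>, \<open>a \<times> b\<close> with the
  three inner products as coefficients.
\<close>

lemma eq_zero_if_orthogonal_to_basis:
  fixes x a b c :: "real^3"
  assumes "(a \<times> b) \<bullet> c \<noteq> 0" and "x \<bullet> a = 0" and "x \<bullet> b = 0" and "x \<bullet> c = 0"
  shows "x = 0"
proof -
  have "((a \<times> b) \<bullet> c) *\<^sub>R x = (x \<bullet> a) *\<^sub>R (b \<times> c) + (x \<bullet> b) *\<^sub>R (c \<times> a) + (x \<bullet> c) *\<^sub>R (a \<times> b)"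
    by (simp add: cross3_simps forall_3)
  with assms show ?thesis by simp
qed

text \<open>
  A bar triangle in \<open>\<real>\<^sup>3\<close> with one vertex at rest moves only by rotating: the three
  hypotheses on \<open>s\<close> and \<open>t\<close> say that its edges \<open>e\<close>, \<open>f\<close> and \<open>f - e\<close> keep their length to
  first order.
\<close>

lemma rotation_from_two_velocities:
  fixes e f s t :: "real^3"
  assumes "e \<times> f \<noteq> 0" and "e \<bullet> s = 0" and "f \<bullet> t = 0" and "e \<bullet> t + f \<bullet> s = 0"
  obtains \<omega> where "\<omega> \<times> e = s" and "\<omega> \<times> f = t"
proof -
  define n where "n = e \<times> f"
  \<comment> \<open>the coefficients in the basis \<open>e\<close>, \<open>f\<close>, \<open>n\<close> are read off from the products with \<open>n\<close> and \<open>f\<close>\<close>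
  define \<omega> where "\<omega> = (1 / (n \<bullet> n)) *\<^sub>R ((t \<bullet> n) *\<^sub>R e - (s \<bullet> n) *\<^sub>R f + (s \<bullet> f) *\<^sub>R n)"
  have n: "n \<bullet> n \<noteq> 0" using assms(1) by (simp add: n_def)
  have "(\<omega> \<times> e) \<bullet> n = s \<bullet> n"
  proof -
    have "(\<omega> \<times> e) \<bullet> n = (1 / (n \<bullet> n)) * ((s \<bullet> n) * ((e \<times> f) \<bullet> n))"
      unfolding \<omega>_def n_def cross_mult_left inner_scaleR_left
      by (simp add: cross3_simps)
    then show ?thesis using n by (simp add: n_def)
  qed
  moreover have "(\<omega> \<times> e) \<bullet> e = s \<bullet> e"
    using assms(2) by (simp add: dot_cross_self inner_commute)
  moreover have "(\<omega> \<times> e) \<bullet> f = s \<bullet> f"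
  proof -
    have "(\<omega> \<times> e) \<bullet> f = (1 / (n \<bullet> n)) * ((s \<bullet> f) * ((e \<times> f) \<bullet> n))"
      unfolding \<omega>_def n_def cross_mult_left inner_scaleR_left
      by (simp add: cross3_simps)
    then show ?thesis using n by (simp add: n_def)
  qed
  ultimately have 1: "\<omega> \<times> e - s = 0"
    using n by (intro eq_zero_if_orthogonal_to_basis[of e f n]) (auto simp: inner_diff_left n_def)
  have "(\<omega> \<times> f) \<bullet> n = t \<bullet> n"
  proof -
    have "(\<omega> \<times> f) \<bullet> n = (1 / (n \<bullet> n)) * ((t \<bullet> n) * ((e \<times> f) \<bullet> n))"
      unfolding \<omega>_def n_def cross_mult_left inner_scaleR_left
      by (simp add: cross3_simps)
    then show ?thesis using n by (simp add: n_def)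
  qed
  moreover have "(\<omega> \<times> f) \<bullet> f = t \<bullet> f"
    using assms(3) by (simp add: dot_cross_self inner_commute)
  moreover have "(\<omega> \<times> f) \<bullet> e = t \<bullet> e"
  proof -
    have "(\<omega> \<times> f) \<bullet> e = - ((\<omega> \<times> e) \<bullet> f)" by (simp add: cross3_simps)
    then show ?thesis using 1 assms(4) by (simp add: inner_commute)
  qed
  ultimately have 2: "\<omega> \<times> f - t = 0"
    using n by (intro eq_zero_if_orthogonal_to_basis[of e f n]) (auto simp: inner_diff_left n_def)
  show ?thesis using that 1 2 by simp
qed

text \<open>
  With \<open>h u = g u - g 0\<close> the hypothesis polarizes to \<open>u \<bullet> h v = - (v \<bullet> h u)\<close>. Each component
  of \<open>h u\<close> is thus the inner product of \<open>u\<close> with a fixed vector, so \<open>h\<close> is linear and skew,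
  hence a cross product.
\<close>

lemma infinitesimal_isometry_R3:
  fixes g :: "real^3 \<Rightarrow> real^3"
  assumes "\<And>u v. (u - v) \<bullet> (g u - g v) = 0"
  obtains \<omega> where "\<And>u. g u = \<omega> \<times> u + g 0"
proof -
  define h where "h u = g u - g 0" for u
  have h: "u \<bullet> h u = 0" for u using assms[of u 0] by (simp add: h_def)
  have skew: "u \<bullet> h v = - (v \<bullet> h u)" for u v
    using assms[of u v] h[of u] h[of v]
    by (simp add: h_def inner_diff_left inner_diff_right algebra_simps)
  have comp: "h u $ i = - (u \<bullet> h (axis i 1))" for u i
    using skew[of "axis i 1" u] by (simp add: inner_axis')
  have ax: "h (axis j 1) $ i = - (h (axis i 1) $ j)" for i j
    using comp[of "axis j 1" i] by (simp add: inner_axis')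
  have diag: "h (axis j 1) $ j = 0" for j using ax[of j j] by simp
  define \<omega> :: "real^3" where
    "\<omega> = vector [h (axis 2 1) $ 3, h (axis 3 1) $ 1, h (axis 1 1) $ 2]"
  have "h u = \<omega> \<times> u" for u
    unfolding vec_eq_iff forall_3 comp
    using ax[of 1 2] ax[of 1 3] ax[of 2 3]
    by (simp add: cross_components \<omega>_def inner_vec_def sum_3 diag algebra_simps)
  then have "g u = \<omega> \<times> u + g 0" for u by (metis h_def diff_add_cancel)
  then show ?thesis using that by blast
qed

text \<open>
  The map \<open>u \<mapsto> u + (2 / (1 + q \<bullet> q)) (q \<times> u + q \<times> (q \<times> u))\<close> is the Cayley transform
  \<open>(1 + Q) (1 - Q)\<^sup>-\<^sup>1\<close> of \<open>Q = q \<times> _\<close>, a rotation about \<open>q\<close>. It depends rationally on \<open>q\<close>,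
  which makes the derivative along a line of parameters \<open>q\<close> easy to compute.
\<close>

lemma norm_Cayley:
  fixes q u :: "real^3"
  shows "norm (u + (2 / (1 + q \<bullet> q)) *\<^sub>R (q \<times> u + q \<times> (q \<times> u))) = norm u"
proof -
  define c where "c = 2 / (1 + q \<bullet> q)"
  define w where "w = q \<times> u"
  have "1 + q \<bullet> q > 0" by (smt (verit) inner_ge_zero)
  then have c: "c * (1 + q \<bullet> q) = 2" by (simp add: c_def field_simps)
  have i: "u \<bullet> w = 0" "w \<bullet> (q \<times> w) = 0" by (auto simp: w_def dot_cross_self)
  have ii: "u \<bullet> (q \<times> w) = - (w \<bullet> w)" unfolding w_def by (simp add: cross3_simps)
  have iii: "(q \<times> w) \<bullet> (q \<times> w) = (q \<bullet> q) * (w \<bullet> w)" unfolding w_def by (simp add: cross3_simps)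
  have "(u + c *\<^sub>R (w + q \<times> w)) \<bullet> (u + c *\<^sub>R (w + q \<times> w))
      = u \<bullet> u + 2 * c * (u \<bullet> w + u \<bullet> (q \<times> w))
        + c * c * (w \<bullet> w + 2 * (w \<bullet> (q \<times> w)) + (q \<times> w) \<bullet> (q \<times> w))"
    by (simp add: inner_add_left inner_add_right inner_commute algebra_simps)
  also have "\<dots> = u \<bullet> u + c * (w \<bullet> w) * (c * (1 + q \<bullet> q) - 2)"
    unfolding i ii iii by (simp add: algebra_simps)
  also have "\<dots> = u \<bullet> u" by (simp add: c)
  finally show ?thesis by (simp add: norm_eq_sqrt_inner c_def w_def)
qed

text \<open>
  Three scalar conditions that kill the three-dimensional space of rotations fixing a vertex
  of a nondegenerate triangle. By the triple product identity they are the products of \<open>\<omega>\<close>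
  with \<open>n\<close>, \<open>e \<times> n\<close> and \<open>f \<times> n\<close> for the normal \<open>n = e \<times> f\<close>, and these form a basis.
\<close>

lemma rotation_eq_0_if_pinned:
  fixes \<omega> e f :: "real^3"
  assumes "e \<times> f \<noteq> 0"
    and "(\<omega> \<times> e) \<bullet> f = 0" and "(\<omega> \<times> e) \<bullet> (e \<times> f) = 0" and "(\<omega> \<times> f) \<bullet> (e \<times> f) = 0"
  shows "\<omega> = 0"
proof (rule eq_zero_if_orthogonal_to_basis[of "e \<times> (e \<times> f)" "f \<times> (e \<times> f)" "e \<times> f"])
  define n where "n = e \<times> f"
  have triple: "a \<bullet> (b \<times> c) = (a \<times> b) \<bullet> c" for a b c :: "real^3" by (simp add: cross3_simps)
  show "\<omega> \<bullet> (e \<times> f) = 0" "\<omega> \<bullet> (e \<times> (e \<times> f)) = 0" "\<omega> \<bullet> (f \<times> (e \<times> f)) = 0"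
    using assms(2-4) by (simp_all add: triple)
  have "((a \<times> c) \<times> (b \<times> c)) = (c \<bullet> (a \<times> b)) *\<^sub>R c" for a b c :: "real^3"
    by (simp add: cross3_simps forall_3)
  then have "(((e \<times> n) \<times> (f \<times> n)) \<bullet> n) = (n \<bullet> n) * (n \<bullet> n)"
    by (simp add: n_def)
  then show "((e \<times> (e \<times> f)) \<times> (f \<times> (e \<times> f))) \<bullet> (e \<times> f) \<noteq> 0"
    using assms(1) by (simp add: n_def)
qed

text \<open>
  One step of propagation: the difference between \<open>y i\<close> and the value prescribed by the
  rotation field is orthogonal to the three bars that join \<open>i\<close> to vertices where the two
  agree.
\<close>

lemma rotation_field_extends:
  fixes q y :: "'i \<Rightarrow> real^3"
  assumes "((q i - q j) \<times> (q i - q k)) \<bullet> (q i - q l) \<noteq> 0"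
    and "(q i - q j) \<bullet> (y i - y j) = 0" and "(q i - q k) \<bullet> (y i - y k) = 0"
    and "(q i - q l) \<bullet> (y i - y l) = 0"
    and "y j = \<omega> \<times> q j + b" and "y k = \<omega> \<times> q k + b" and "y l = \<omega> \<times> q l + b"
  shows "y i = \<omega> \<times> q i + b"
proof -
  define d where "d = y i - (\<omega> \<times> q i + b)"
  have d: "d \<bullet> (q i - q h) = 0"
    if "(q i - q h) \<bullet> (y i - y h) = 0" "y h = \<omega> \<times> q h + b" for h
  proof -
    define D where "D = q i - q h"
    have "d = (y i - y h) - \<omega> \<times> D"
      by (simp add: d_def D_def that(2) Cross3.right_diff_distrib)
    then have "d \<bullet> D = D \<bullet> (y i - y h) - (\<omega> \<times> D) \<bullet> D"
      by (simp only: inner_diff_left inner_commute[of _ "y i - y h"])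
    then show ?thesis using that(1) by (simp only: D_def dot_cross_self)
  qed
  have "d = 0" using assms by (intro eq_zero_if_orthogonal_to_basis[of "q i - q j" "q i - q k" "q i - q l"] d)
  then show ?thesis by (simp add: d_def)
qed

lemma rotation_field_on_triangle:
  fixes q y :: "'i \<Rightarrow> real^3"
  assumes "(q j - q i) \<times> (q k - q i) \<noteq> 0"
    and "(q j - q i) \<bullet> (y j - y i) = 0" and "(q k - q i) \<bullet> (y k - y i) = 0"
    and "(q k - q j) \<bullet> (y k - y j) = 0"
  obtains \<omega> b where "y i = \<omega> \<times> q i + b" and "y j = \<omega> \<times> q j + b" and "y k = \<omega> \<times> q k + b"
proof -
  have "(q j - q i) \<bullet> (y k - y i) + (q k - q i) \<bullet> (y j - y i) = 0"
    using assms(2-4) by (simp add: inner_diff_left inner_diff_right)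
  from rotation_from_two_velocities[OF assms(1-3) this]
  obtain \<omega> where "\<omega> \<times> (q j - q i) = y j - y i" "\<omega> \<times> (q k - q i) = y k - y i" by blast
  then show ?thesis
    by (intro that[of \<omega> "y i - \<omega> \<times> q i"]) (simp_all add: Cross3.right_diff_distrib algebra_simps)
qed

section \<open>The cylinder norm and its derivative\<close>

text \<open>
  The space in coordinates: \<open>base\<close> is the projection to the Euclidean factor \<open>\<real>\<^sup>3\<close>, \<open>height\<close>
  the one to \<open>\<real>\<close>, and \<open>point\<close> the inverse of the pair.
\<close>

locale hyper_cylinder =
  fixes base :: "'a::real_normed_vector \<Rightarrow> real^3"
    and height :: "'a \<Rightarrow> real"
    and point :: "real^3 \<Rightarrow> real \<Rightarrow> 'a"
  assumes linear_base: "linear base"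
    and linear_height: "linear height"
    and base_point [simp]: "base (point u h) = u"
    and height_point [simp]: "height (point u h) = h"
    and point_base_height [simp]: "point (base x) (height x) = x"
    and norm_eq: "norm x = max (norm (base x)) \<bar>height x\<bar>"
begin

sublocale base: bounded_linear base
proof -
  have "norm (base x) \<le> norm x * 1" for x by (simp add: norm_eq)
  then show "bounded_linear base"
    using linear_base by (intro bounded_linear_intro[of _ 1]) (auto simp: linear_add linear_scale)
qed

sublocale height: bounded_linear height
proof -
  have "norm (height x) \<le> norm x * 1" for x by (simp add: norm_eq)
  then show "bounded_linear height"
    using linear_height by (intro bounded_linear_intro[of _ 1]) (auto simp: linear_add linear_scale)
qed

lemma eq_iff_coordinates: "x = y \<longleftrightarrow> base x = base y \<and> height x = height y"
  by (metis point_base_height)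

text \<open>
  Off the double cone \<open>\<bar>base x\<bar> = \<bar>height x\<bar>\<close> exactly one of the two terms of the maximum is
  active, and the norm is smooth.
\<close>

definition off_cone :: "'a \<Rightarrow> bool" where
  "off_cone x \<longleftrightarrow> norm (base x) \<noteq> \<bar>height x\<bar>"

text \<open>
  The derivative of the norm at a point off the cone. At a nonzero point of the cone it is
  one of several support functionals, which serves to refute smoothness there.
\<close>

definition dnorm :: "'a \<Rightarrow> 'a \<Rightarrow> real" where
  "dnorm x z = (if norm (base x) > \<bar>height x\<bar> then sgn (base x) \<bullet> base z
                else sgn (height x) * height z)"

lemma dnorm_bounded_linear: "bounded_linear (dnorm x)"
proof -
  have "bounded_linear (\<lambda>z. sgn (base x) \<bullet> base z)"
    by (intro bounded_linear_compose[OF bounded_linear_inner_right] base.bounded_linear_axioms)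
  moreover have "bounded_linear (\<lambda>z. sgn (height x) * height z)"
    by (intro bounded_linear_compose[OF bounded_linear_mult_right] height.bounded_linear_axioms)
  ultimately show ?thesis unfolding dnorm_def by (cases "norm (base x) > \<bar>height x\<bar>") auto
qed

lemma dnorm_le_norm: "\<bar>dnorm x z\<bar> \<le> norm z"
proof -
  have "\<bar>sgn (base x) \<bullet> base z\<bar> \<le> norm (base z)"
    using Cauchy_Schwarz_ineq2[of "sgn (base x)" "base z"]
    by (auto simp: norm_sgn split: if_splits)
  moreover have "\<bar>sgn (height x) * height z\<bar> \<le> \<bar>height z\<bar>"
    by (auto simp: abs_mult sgn_if)
  ultimately show ?thesis by (auto simp: dnorm_def norm_eq)
qed

lemma dnorm_self: "dnorm x x = norm x"
proof -
  have "sgn (base x) \<bullet> base x = norm (base x)"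
    by (cases "base x = 0") (simp_all add: sgn_div_norm dot_square_norm power2_eq_square)
  moreover have "sgn (height x) * height x = \<bar>height x\<bar>" by (simp add: sgn_if)
  ultimately show ?thesis by (simp add: dnorm_def norm_eq)
qed

lemma dnorm_minus_minus: "dnorm (- x) (- z) = dnorm x z"
  by (simp add: dnorm_def base.neg height.neg sgn_minus)

lemma off_cone_scale: "c \<noteq> 0 \<Longrightarrow> off_cone (c *\<^sub>R x) \<longleftrightarrow> off_cone x"
  by (simp add: off_cone_def base.scaleR height.scaleR abs_mult)

lemma dnorm_eq_0_iff:
  assumes "off_cone x"
  shows "dnorm x z = 0 \<longleftrightarrow> (if norm (base x) > \<bar>height x\<bar> then base x \<bullet> base z = 0 else height z = 0)"
  using assms by (auto simp: dnorm_def off_cone_def sgn_div_norm sgn_zero_iff)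

text \<open>
  Near \<open>t = 0\<close> the strict inequality between \<open>base\<close> and \<open>height\<close> persists, so the norm
  coincides with the Euclidean norm of \<open>base\<close> or with the absolute value of \<open>height\<close>. Rigid
  motions move points along curves, flexes along lines.
\<close>

lemma norm_curve_derivative:
  assumes "off_cone (\<gamma> 0)" and "(\<gamma> has_vector_derivative z) (at 0)"
  shows "((\<lambda>t. norm (\<gamma> t)) has_real_derivative dnorm (\<gamma> 0) z) (at 0)"
proof -
  have db: "((\<lambda>t. base (\<gamma> t)) has_vector_derivative base z) (at 0)"
    by (rule base.has_vector_derivative[OF assms(2)])
  have dh: "((\<lambda>t. height (\<gamma> t)) has_vector_derivative height z) (at 0)"
    by (rule height.has_vector_derivative[OF assms(2)])
  have cb: "isCont (\<lambda>t. norm (base (\<gamma> t))) 0"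
    using has_vector_derivative_continuous[OF db] by (intro continuous_norm)
  have ch: "isCont (\<lambda>t. \<bar>height (\<gamma> t)\<bar>) 0"
    using has_vector_derivative_continuous[OF dh] by (intro continuous_rabs)
  have near: "\<forall>\<^sub>F t in nhds 0. f t < g t" if "isCont f 0" "isCont g 0" "f 0 < g 0"
    for f g :: "real \<Rightarrow> real"
  proof -
    have "((\<lambda>t. g t - f t) \<longlongrightarrow> g 0 - f 0) (nhds 0)"
      using that by (intro tendsto_diff) (auto simp: isCont_def tendsto_at_iff_tendsto_nhds)
    then have "\<forall>\<^sub>F t in nhds 0. 0 < g t - f t" using that(3) by (intro order_tendstoD(1)) auto
    then show ?thesis by eventually_elim simp
  qed
  show ?thesis
  proof (cases "norm (base (\<gamma> 0)) > \<bar>height (\<gamma> 0)\<bar>")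
    case True
    then have ne: "base (\<gamma> 0) \<noteq> 0" by auto
    have "(norm has_derivative (\<lambda>h. h \<bullet> sgn (base (\<gamma> 0)))) (at (base (\<gamma> 0)))"
      by (rule has_derivative_norm[OF ne])
    from has_derivative_compose[OF db[unfolded has_vector_derivative_def] this]
    have "((\<lambda>t. norm (base (\<gamma> t))) has_real_derivative base z \<bullet> sgn (base (\<gamma> 0))) (at 0)"
      by (simp add: has_field_derivative_def mult_commute_abs)
    moreover have "\<forall>\<^sub>F t in nhds 0. norm (base (\<gamma> t)) = norm (\<gamma> t)"
      using near[OF ch cb True] by eventually_elim (simp add: norm_eq)
    ultimately show ?thesis
      using True DERIV_cong_ev[OF refl _ refl, of "\<lambda>t. norm (base (\<gamma> t))" "\<lambda>t. norm (\<gamma> t)"]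
      by (auto simp: dnorm_def inner_commute)
  next
    case False
    then have lt: "norm (base (\<gamma> 0)) < \<bar>height (\<gamma> 0)\<bar>" using assms(1) by (auto simp: off_cone_def)
    then have ne: "height (\<gamma> 0) \<noteq> 0" by auto
    have "(norm has_derivative (\<lambda>h. h \<bullet> sgn (height (\<gamma> 0)))) (at (height (\<gamma> 0)))"
      by (rule has_derivative_norm[OF ne])
    from has_derivative_compose[OF dh[unfolded has_vector_derivative_def] this]
    have "((\<lambda>t. \<bar>height (\<gamma> t)\<bar>) has_real_derivative height z * sgn (height (\<gamma> 0))) (at 0)"
      by (simp add: has_field_derivative_def mult.assoc mult_commute_abs)
    moreover have "\<forall>\<^sub>F t in nhds 0. \<bar>height (\<gamma> t)\<bar> = norm (\<gamma> t)"
      using near[OF cb ch lt] by eventually_elim (simp add: norm_eq)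
    ultimately show ?thesis
      using False DERIV_cong_ev[OF refl _ refl, of "\<lambda>t. \<bar>height (\<gamma> t)\<bar>" "\<lambda>t. norm (\<gamma> t)"]
      by (auto simp: dnorm_def mult.commute)
  qed
qed

corollary norm_line_derivative:
  assumes "off_cone x"
  shows "((\<lambda>t. norm (x + t *\<^sub>R z)) has_real_derivative dnorm x z) (at 0)"
proof -
  have "((\<lambda>t. x + t *\<^sub>R z) has_vector_derivative z) (at 0)"
    by (auto intro!: derivative_eq_intros)
  from norm_curve_derivative[OF _ this] assms show ?thesis by simp
qed

lemma support_functional_dnorm:
  assumes "norm x = 1"
  shows "support_functional (dnorm x) x"
proof -
  have "onorm (dnorm x) \<le> 1" by (rule onorm_bound) (simp_all add: dnorm_le_norm)
  then show ?thesis using assms by (simp add: support_functional_def dnorm_bounded_linear dnorm_self)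
qed

lemma support_functional_le_norm:
  assumes "support_functional f x"
  shows "f z \<le> norm z"
proof -
  have bl: "bounded_linear f" and le: "onorm f \<le> 1"
    using assms by (auto simp: support_functional_def)
  have "norm (f z) \<le> onorm f * norm z" by (rule onorm[OF bl])
  also have "\<dots> \<le> norm z" using le mult_right_mono[OF le, of "norm z"] by simp
  finally show ?thesis by simp
qed

text \<open>
  For a support functional \<open>f\<close> at \<open>x\<close>, the function \<open>t \<mapsto> norm (x + t z) - f (x + t z)\<close> is
  nonnegative and vanishes at \<open>0\<close>, so its derivative there is zero; this determines \<open>f z\<close>.
\<close>

lemma support_functional_unique:
  assumes "off_cone x" and "norm x = 1" and f: "support_functional f x"
  shows "f = dnorm x"
proof
  fix z
  interpret f: bounded_linear f using f by (simp add: support_functional_def)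
  have min: "norm (x + 0 *\<^sub>R z) - (1 + 0 * f z) \<le> norm (x + t *\<^sub>R z) - (1 + t * f z)" for t
    using support_functional_le_norm[OF f, of "x + t *\<^sub>R z"] f assms(2)
    by (simp add: f.add f.scaleR support_functional_def)
  have "((\<lambda>t. norm (x + t *\<^sub>R z) - (1 + t * f z)) has_real_derivative dnorm x z - f z) (at 0)"
    by (auto intro!: derivative_eq_intros norm_line_derivative assms(1))
  then have "dnorm x z - f z = 0"
    by (rule DERIV_local_min[of _ _ _ 1]) (use min in simp_all)
  then show "f z = dnorm x z" by simp
qed

text \<open>
  At a nonzero point of the cone both terms of the maximum yield a support functional; the
  two differ on the vertical direction.
\<close>

lemma norm_smooth_at_iff: "norm_smooth_at x \<longleftrightarrow> off_cone x"
proof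
  assume "norm_smooth_at x"
  then have "x \<noteq> 0" and uniq: "\<And>f g. support_functional f (x /\<^sub>R norm x) \<Longrightarrow>
      support_functional g (x /\<^sub>R norm x) \<Longrightarrow> f = g"
    by (auto simp: norm_smooth_at_def)
  show "off_cone x"
  proof (rule ccontr)
    define y where "y = x /\<^sub>R norm x"
    assume "\<not> off_cone x"
    then have "\<not> off_cone y" using \<open>x \<noteq> 0\<close> by (simp add: y_def off_cone_scale)
    have ny: "norm y = 1" using \<open>x \<noteq> 0\<close> by (simp add: y_def)
    have nb: "norm (base y) = 1" and nh: "\<bar>height y\<bar> = 1"
      using \<open>\<not> off_cone y\<close> ny by (auto simp: off_cone_def norm_eq)
    define f where "f = (\<lambda>z. base y \<bullet> base z)"
    have blf: "bounded_linear f" unfolding f_def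
      by (intro bounded_linear_compose[OF bounded_linear_inner_right] base.bounded_linear_axioms)
    have "\<bar>f z\<bar> \<le> norm z" for z
      using Cauchy_Schwarz_ineq2[of "base y" "base z"] nb by (simp add: f_def norm_eq)
    then have "onorm f \<le> 1" by (intro onorm_bound) simp_all
    moreover have "f y = 1" using nb by (simp add: f_def norm_eq_sqrt_inner)
    ultimately have "support_functional f y" using blf by (simp add: support_functional_def)
    from uniq[OF this[unfolded y_def] support_functional_dnorm[OF ny, unfolded y_def]]
    have "f (point 0 1) = dnorm y (point 0 1)" by (simp add: y_def)
    then show False using nb nh by (auto simp: f_def dnorm_def sgn_if split: if_splits)
  qed
next
  assume x: "off_cone x"
  then have "x \<noteq> 0" by (auto simp: off_cone_def base.zero height.zero)
  then show "norm_smooth_at x"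
    unfolding norm_smooth_at_def
    using support_functional_dnorm[of "x /\<^sub>R norm x"] support_functional_unique[of "x /\<^sub>R norm x"] x
    by (auto simp: off_cone_scale intro!: ex1I)
qed

section \<open>Infinitesimal rigid motions\<close>

definition motion :: "real^3 \<Rightarrow> real^3 \<Rightarrow> real \<Rightarrow> 'a \<Rightarrow> 'a" where
  "motion \<omega> b c x = point (\<omega> \<times> base x + b) c"

lemma rigid_motion_preserves_norm_infinitesimally:
  assumes "rigid_motion \<alpha>" and "off_cone (x - y)"
  shows "dnorm (x - y) (vector_derivative (\<alpha> x) (at 0) - vector_derivative (\<alpha> y) (at 0)) = 0"
proof -
  define \<gamma> where "\<gamma> t = \<alpha> x t - \<alpha> y t" for t
  have d: "(\<alpha> v has_vector_derivative vector_derivative (\<alpha> v) (at 0)) (at 0)" for v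
    using assms(1) by (simp add: rigid_motion_def vector_derivative_works [symmetric])
  have "(\<gamma> has_vector_derivative
      (vector_derivative (\<alpha> x) (at 0) - vector_derivative (\<alpha> y) (at 0))) (at 0)"
    unfolding \<gamma>_def by (intro has_vector_derivative_diff d)
  moreover have \<gamma>0: "\<gamma> 0 = x - y" using assms(1) by (simp add: \<gamma>_def rigid_motion_def)
  ultimately have "((\<lambda>t. norm (\<gamma> t)) has_real_derivative dnorm (x - y)
      (vector_derivative (\<alpha> x) (at 0) - vector_derivative (\<alpha> y) (at 0))) (at 0)"
    using norm_curve_derivative[of \<gamma>] assms(2) by simp
  moreover have "norm (\<gamma> t) = norm (x - y)" if "\<bar>0 - t\<bar> < 1" for t
  proof -
    have "t \<in> {-1..1}" using that by auto
    then show ?thesis using assms(1) by (simp add: \<gamma>_def rigid_motion_def)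
  qed
  ultimately show ?thesis using \<gamma>0 DERIV_local_const[of _ _ 0 1] by simp
qed

text \<open>
  A point high enough above the origin is seen steeply both from the origin and from any
  given \<open>x\<close>, so all three share their vertical velocity. Two points on the same vertical
  line have the same horizontal velocity, since the difference is orthogonal to the
  direction towards every point far away horizontally. What remains is a first-order
  isometry of \<open>\<real>\<^sup>3\<close>.
\<close>

lemma inf_rigid_motion_is_motion:
  assumes "\<eta> \<in> inf_rigid_motions"
  obtains \<omega> b c where "\<eta> = motion \<omega> b c"
proof -
  obtain \<alpha> where \<alpha>: "rigid_motion \<alpha>" and \<eta>: "\<And>x. \<eta> x = vector_derivative (\<alpha> x) (at 0)"
    using assms by (auto simp: inf_rigid_motions_def)
  have d: "dnorm (x - y) (\<eta> x - \<eta> y) = 0" if "off_cone (x - y)" for x y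
    using rigid_motion_preserves_norm_infinitesimally[OF \<alpha> that] by (simp add: \<eta>)
  have steep: "height (\<eta> x) = height (\<eta> y)" if "norm (base x - base y) < \<bar>height x - height y\<bar>" for x y
  proof -
    have "off_cone (x - y)" using that by (simp add: off_cone_def base.diff height.diff)
    from d[OF this] dnorm_eq_0_iff[OF this, of "\<eta> x - \<eta> y"] that
    show ?thesis by (simp add: base.diff height.diff)
  qed
  have flat: "(base x - base y) \<bullet> (base (\<eta> x) - base (\<eta> y)) = 0"
    if "norm (base x - base y) > \<bar>height x - height y\<bar>" for x y
  proof -
    have "off_cone (x - y)" using that by (simp add: off_cone_def base.diff height.diff)
    from d[OF this] dnorm_eq_0_iff[OF this, of "\<eta> x - \<eta> y"] that
    show ?thesis by (simp add: base.diff height.diff)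
  qed
  have const: "height (\<eta> x) = height (\<eta> 0)" for x
  proof -
    define r where "r = norm (base x) + \<bar>height x\<bar> + 1"
    have r: "r > 0" "norm (base x) < \<bar>height x - r\<bar>"
      by (auto simp: r_def add_nonneg_pos abs_if)
    define w where "w = point 0 r"
    have "height (\<eta> x) = height (\<eta> w)" by (rule steep) (use r in \<open>simp add: w_def\<close>)
    also have "\<dots> = height (\<eta> 0)" by (rule steep) (use r in \<open>simp add: w_def base.zero height.zero\<close>)
    finally show ?thesis .
  qed
  define g where "g u = base (\<eta> (point u 0))" for u
  have g: "base (\<eta> x) = g (base x)" for x
  proof -
    \<comment> \<open>the discrepancy \<open>D\<close> is tested against a point that lies far away in the direction of \<open>D\<close> itself\<close>
    define D where "D = base (\<eta> x) - g (base x)"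
    show ?thesis
    proof (cases "D = 0")
      case False
      define k where "k = (\<bar>height x\<bar> + 1) / norm D"
      define y where "y = point (base x + k *\<^sub>R D) 0"
      have "k > 0" using False by (simp add: k_def)
      have far: "norm (base x - base y) = \<bar>height x\<bar> + 1"
        using False by (simp add: y_def k_def)
      have "(base x - base y) \<bullet> (base (\<eta> x) - base (\<eta> y)) = 0"
        by (rule flat) (use far in \<open>simp add: y_def\<close>)
      moreover have "(base x - base y) \<bullet> (g (base x) - base (\<eta> y)) = 0"
        using flat[of "point (base x) 0" y] far by (simp add: y_def g_def)
      ultimately have "(base x - base y) \<bullet> D = 0"
        by (simp add: D_def inner_diff_right)
      then show ?thesis using \<open>k > 0\<close> False by (simp add: y_def)
    qed (simp add: D_def)
  qed
  have "(u - v) \<bullet> (g u - g v) = 0" for u v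
    using flat[of "point u 0" "point v 0"] by (cases "u = v") (auto simp: g_def)
  from infinitesimal_isometry_R3[OF this] obtain \<omega> where \<omega>: "\<And>u. g u = \<omega> \<times> u + g 0" by blast
  have "\<eta> = motion \<omega> (g 0) (height (\<eta> 0))"
    by (rule ext) (metis const g \<omega> motion_def point_base_height)
  then show ?thesis using that by blast
qed

text \<open>
  The path is \<open>(u, h) \<mapsto> (R t u + t b, h + t c)\<close> with \<open>R t\<close> the Cayley rotation for
  \<open>q = (t / 2) \<omega>\<close>, whose derivative at \<open>0\<close> is \<open>\<omega> \<times> u\<close>. It is written as a combination of
  fixed vectors of the space with scalar coefficients \<open>r1\<close> and \<open>r2\<close>, so that only real
  functions have to be differentiated.
\<close>

lemma motion_in_inf_rigid_motions: "motion \<omega> b c \<in> inf_rigid_motions"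
proof -
  define s where "s = (\<omega> \<bullet> \<omega>) / 4"
  have pos: "1 + t\<^sup>2 * s > 0" for t by (simp add: s_def add_pos_nonneg)
  define r1 where "r1 t = t / (1 + t\<^sup>2 * s)" for t
  define r2 where "r2 t = (t\<^sup>2 / 2) / (1 + t\<^sup>2 * s)" for t
  define \<alpha> where "\<alpha> x t = x + r1 t *\<^sub>R point (\<omega> \<times> base x) 0
      + r2 t *\<^sub>R point (\<omega> \<times> (\<omega> \<times> base x)) 0 + t *\<^sub>R point b c" for x t
  have base_\<alpha>: "base (\<alpha> x t - \<alpha> y t) = (base x - base y) + r1 t *\<^sub>R (\<omega> \<times> (base x - base y))
      + r2 t *\<^sub>R (\<omega> \<times> (\<omega> \<times> (base x - base y)))" for x y t
    by (simp add: \<alpha>_def base.add base.diff base.scaleR Cross3.right_diff_distrib algebra_simps)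
  have "norm (base (\<alpha> x t - \<alpha> y t)) = norm (base (x - y))" for x y t
  proof -
    define q where "q = (t / 2) *\<^sub>R \<omega>"
    have qq: "q \<bullet> q = t\<^sup>2 * s" by (simp add: q_def s_def power2_eq_square)
    have r1: "r1 t = 2 / (1 + q \<bullet> q) * (t / 2)"
      unfolding qq r1_def using pos[of t] by (simp add: field_simps)
    have r2: "r2 t = 2 / (1 + q \<bullet> q) * (t / 2 * (t / 2))"
      unfolding qq r2_def using pos[of t] by (simp add: field_simps power2_eq_square)
    have "base (\<alpha> x t - \<alpha> y t) = base (x - y) + (2 / (1 + q \<bullet> q)) *\<^sub>R
        (q \<times> base (x - y) + q \<times> (q \<times> base (x - y)))"
      unfolding base_\<alpha> r1 r2
      by (simp only: q_def cross_mult_left cross_mult_right base.diff scaleR_add_right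
          scaleR_scaleR add.assoc)
    then show ?thesis by (simp add: norm_Cayley)
  qed
  moreover have "height (\<alpha> x t - \<alpha> y t) = height (x - y)" for x y t
    by (simp add: \<alpha>_def height.add height.diff height.scaleR)
  ultimately have isometry: "norm (\<alpha> x t - \<alpha> y t) = norm (x - y)" for x y t
    by (simp add: norm_eq)
  have dr1: "(r1 has_real_derivative 1) (at 0)"
    unfolding r1_def using pos by (auto intro!: derivative_eq_intros)
  have dr2: "(r2 has_real_derivative 0) (at 0)"
    unfolding r2_def using pos by (auto intro!: derivative_eq_intros)
  have scale: "((\<lambda>t. r t *\<^sub>R v) has_vector_derivative d *\<^sub>R v) (at 0)"
    if "(r has_real_derivative d) (at 0)" for r d and v :: 'a
    using has_vector_derivative_scaleR[OF that has_vector_derivative_const] by simp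
  have deriv: "(\<alpha> x has_vector_derivative motion \<omega> b c x) (at 0)" for x
  proof -
    have "(\<alpha> x has_vector_derivative
        (0 + 1 *\<^sub>R point (\<omega> \<times> base x) 0 + 0 *\<^sub>R point (\<omega> \<times> (\<omega> \<times> base x)) 0 + 1 *\<^sub>R point b c)) (at 0)"
      unfolding \<alpha>_def
      by (intro has_vector_derivative_add has_vector_derivative_const scale dr1 dr2 DERIV_ident)
    moreover have "0 + 1 *\<^sub>R point (\<omega> \<times> base x) 0 + 0 *\<^sub>R point (\<omega> \<times> (\<omega> \<times> base x)) 0 + 1 *\<^sub>R point b c
        = motion \<omega> b c x"
      by (simp add: eq_iff_coordinates motion_def base.add height.add)
    ultimately show ?thesis by simp
  qed
  have "continuous_on {-1..1} (\<alpha> x)" for x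
    unfolding \<alpha>_def r1_def r2_def
    by (intro continuous_intros) (use pos in \<open>auto simp: less_imp_neq [symmetric] dest: less_imp_neq\<close>)
  moreover have "\<alpha> x 0 = x" for x by (simp add: \<alpha>_def r1_def r2_def)
  moreover have "\<alpha> x differentiable (at 0)" for x
    using deriv by (rule differentiableI_vector)
  ultimately have "rigid_motion \<alpha>"
    using isometry by (simp add: rigid_motion_def)
  then show ?thesis
    unfolding inf_rigid_motions_def using vector_derivative_at[OF deriv] by fastforce
qed

text \<open>
  If the projections lie on a line, the rotation about that line is a nonzero motion that
  vanishes on \<open>S\<close>. If they do not, a motion is determined by its values at three points with
  noncollinear projections.
\<close>

lemma full_set_iff_noncollinear:
  "full_set S \<longleftrightarrow> (\<exists>x\<in>S. \<exists>y\<in>S. \<exists>z\<in>S. (base y - base x) \<times> (base z - base x) \<noteq> 0)"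
proof
  assume full: "full_set S"
  then obtain x where "x \<in> S" by (auto simp: full_set_def)
  show "\<exists>x\<in>S. \<exists>y\<in>S. \<exists>z\<in>S. (base y - base x) \<times> (base z - base x) \<noteq> 0"
  proof (rule ccontr)
    assume "\<not> ?thesis"
    then have collinear: "(base y - base x) \<times> (base z - base x) = 0" if "y \<in> S" "z \<in> S" for y z
      using that \<open>x \<in> S\<close> by blast
    \<comment> \<open>an axis of the line, arbitrary if all projections coincide\<close>
    obtain \<omega> :: "real^3" where "\<omega> \<noteq> 0" and \<omega>: "\<And>z. z \<in> S \<Longrightarrow> \<omega> \<times> (base z - base x) = 0"
    proof (cases "\<exists>y\<in>S. base y \<noteq> base x")
      case True
      then show ?thesis using that collinear by (metis right_minus_eq)
    next
      case False
      then show ?thesis using that[of "axis 1 1"] by (simp add: axis_eq_0_iff)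
    qed
    have "restrict (motion \<omega> (- (\<omega> \<times> base x)) 0) S = restrict (motion 0 0 0) S"
    proof (rule restrict_ext)
      fix z assume "z \<in> S"
      then have "\<omega> \<times> base z - \<omega> \<times> base x = 0" using \<omega>[of z] by (simp add: Cross3.right_diff_distrib)
      then show "motion \<omega> (- (\<omega> \<times> base x)) 0 z = motion 0 0 0 z" by (simp add: motion_def)
    qed
    then have "motion \<omega> (- (\<omega> \<times> base x)) 0 = motion 0 0 0"
      using full motion_in_inf_rigid_motions by (auto simp: full_set_def dest: inj_onD)
    then have "base (motion \<omega> (- (\<omega> \<times> base x)) 0 (point (base x + u) 0)) = 0" for u
      by (simp add: motion_def)
    then have "\<omega> \<times> u = 0" for u by (simp add: motion_def cross_add_right)
    then show False
      using \<open>\<omega> \<noteq> 0\<close> rotation_eq_0_if_pinned[of "axis 1 1" "axis 2 1" \<omega>]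
      by (simp add: cross_basis axis_eq_0_iff)
  qed
next
  assume "\<exists>x\<in>S. \<exists>y\<in>S. \<exists>z\<in>S. (base y - base x) \<times> (base z - base x) \<noteq> 0"
  then obtain x y z where S: "x \<in> S" "y \<in> S" "z \<in> S"
    and n: "(base y - base x) \<times> (base z - base x) \<noteq> 0" by blast
  have "inj_on (\<lambda>\<eta>. restrict \<eta> S) inf_rigid_motions"
  proof (rule inj_onI)
    fix \<eta> \<eta>' :: "'a \<Rightarrow> 'a"
    assume T: "\<eta> \<in> inf_rigid_motions" "\<eta>' \<in> inf_rigid_motions" and "restrict \<eta> S = restrict \<eta>' S"
    then have eq: "\<eta> v = \<eta>' v" if "v \<in> S" for v using that by (metis restrict_apply')
    obtain \<omega> b c where \<eta>: "\<eta> = motion \<omega> b c" using T(1) by (rule inf_rigid_motion_is_motion)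
    obtain \<omega>' b' c' where \<eta>': "\<eta>' = motion \<omega>' b' c'" using T(2) by (rule inf_rigid_motion_is_motion)
    have c: "c = c'" and b: "\<And>v. v \<in> S \<Longrightarrow> \<omega> \<times> base v + b = \<omega>' \<times> base v + b'"
      using eq S by (auto simp: \<eta> \<eta>' motion_def eq_iff_coordinates)
    have diff: "(\<omega> - \<omega>') \<times> (base v - base x) = 0" if "v \<in> S" for v
    proof -
      have "(\<omega> - \<omega>') \<times> (base v - base x) =
          (\<omega> \<times> base v + b - (\<omega>' \<times> base v + b')) - (\<omega> \<times> base x + b - (\<omega>' \<times> base x + b'))"
        by (simp add: Cross3.right_diff_distrib Cross3.left_diff_distrib)
      then show ?thesis using b[OF that] b[OF S(1)] by simp
    qed
    have "\<omega> - \<omega>' = 0"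
      by (rule rotation_eq_0_if_pinned[OF n]) (simp_all add: diff S)
    then show "\<eta> = \<eta>'" using b[OF S(1)] c by (simp add: \<eta> \<eta>')
  qed
  then show "full_set S" using S by (auto simp: full_set_def)
qed

section \<open>Infinitesimal flexes as a linear system\<close>

text \<open>
  The difference quotients of the rigidity map converge to the values of \<open>dnorm\<close>, which
  turns the limit condition into a linear system.
\<close>

lemma infinitesimal_flex_iff:
  assumes "finite_simple_graph G" and "well_positioned G p"
  shows "infinitesimal_flex G p z \<longleftrightarrow>
    (\<forall>v w. {v, w} \<in> edges G \<longrightarrow> dnorm (p v - p w) (z v - z w) = 0)"
proof -
  define Q where "Q e = (\<lambda>t. (1 / t) * (rigidity_map G (\<lambda>v. p v + t *\<^sub>R z v) e - rigidity_map G p e))"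
    for e
  have lim: "(Q {v, w} \<longlongrightarrow> dnorm (p v - p w) (z v - z w)) (at 0)" if e: "{v, w} \<in> edges G" for v w
  proof -
    have "off_cone (p v - p w)" using assms(2) e by (simp add: well_positioned_def norm_smooth_at_iff)
    from norm_line_derivative[OF this, of "z v - z w"]
    show ?thesis
      unfolding Q_def rigidity_map_edge[OF e] DERIV_def
      by (simp add: scaleR_diff_right algebra_simps diff_divide_distrib)
  qed
  have ends: "\<exists>v w. e = {v, w}" if "e \<in> edges G" for e
    using assms(1) that by (meson card_2_iff finite_simple_graph_def)
  have "infinitesimal_flex G p z \<longleftrightarrow> (\<forall>e\<in>edges G. (Q e \<longlongrightarrow> 0) (at 0))"
    by (simp add: infinitesimal_flex_def Q_def)
  also have "\<dots> \<longleftrightarrow> (\<forall>v w. {v, w} \<in> edges G \<longrightarrow> (Q {v, w} \<longlongrightarrow> 0) (at 0))"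
    using ends by blast
  also have "\<dots> \<longleftrightarrow> (\<forall>v w. {v, w} \<in> edges G \<longrightarrow> dnorm (p v - p w) (z v - z w) = 0)"
    using lim by (metis LIM_unique)
  finally show ?thesis .
qed

section \<open>The number of edges of a rigid framework\<close>

text \<open>
  Pin a vertex \<open>v0\<close> and impose three further linear conditions; among the motions with \<open>v0\<close>
  at rest only zero satisfies them. By rigidity a solution of the edge equations together
  with these pins is zero. So the \<open>\<bar>E\<bar> + 3\<close> equations cannot be fewer than the \<open>4 (n - 1)\<close>
  unknowns.
\<close>

lemma edge_count_if_rigid:
  fixes G :: "'v graph" and p :: "'v \<Rightarrow> 'a"
  assumes simple: "finite_simple_graph G" and full: "full_framework G p"
    and wp: "well_positioned G p" and rigid: "infinitesimally_rigid G p"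
  shows "3 \<le> card (verts G)" and "4 * card (verts G) \<le> card (edges G) + 7"
proof -
  define V where "V = verts G"
  have finV: "finite V" using simple by (simp add: V_def finite_simple_graph_def)
  have "edges G \<subseteq> Pow V" using simple by (auto simp: V_def finite_simple_graph_def)
  then have finE: "finite (edges G)" using finV by (meson finite_Pow_iff finite_subset)
  obtain v0 v1 v2 where V: "v0 \<in> V" "v1 \<in> V" "v2 \<in> V"
    and nc: "(base (p v1) - base (p v0)) \<times> (base (p v2) - base (p v0)) \<noteq> 0"
    using full unfolding full_framework_def full_set_iff_noncollinear V_def by blast
  have "v0 \<noteq> v1" "v0 \<noteq> v2" "v1 \<noteq> v2" using nc by auto
  then have "card {v0, v1, v2} = 3" by simp
  moreover have "{v0, v1, v2} \<subseteq> V" using V by simp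
  ultimately show card3: "3 \<le> card (verts G)" using finV by (metis V_def card_mono)
  define e where "e = base (p v1) - base (p v0)"
  define f where "f = base (p v2) - base (p v0)"
  have "\<forall>d\<in>edges G. \<exists>v w. d = {v, w}"
    using simple by (meson card_2_iff finite_simple_graph_def)
  then obtain s t where st: "\<And>d. d \<in> edges G \<Longrightarrow> d = {s d, t d}" by metis
  \<comment> \<open>the velocity field with the given coordinates; the fourth coordinate is the vertical one\<close>
  define Z :: "('v \<times> 4 \<Rightarrow> real) \<Rightarrow> 'v \<Rightarrow> 'a" where
    "Z x v = point (vector [x (v, 1), x (v, 2), x (v, 3)]) (x (v, 4))" for x v
  have Z_lin: "Z (\<lambda>i. a * x i + b * y i) v = a *\<^sub>R Z x v + b *\<^sub>R Z y v" for a b x y v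
    by (simp add: Z_def eq_iff_coordinates vec_eq_iff forall_3 base.add base.scaleR height.add height.scaleR)
  have Z_0: "Z x v = 0 \<longleftrightarrow> (\<forall>k. x (v, k) = 0)" for x v
    by (auto simp: Z_def eq_iff_coordinates vec_eq_iff forall_3 forall_4 base.zero height.zero)
  define L :: "'v set + nat \<Rightarrow> ('v \<times> 4 \<Rightarrow> real) \<Rightarrow> real" where
    "L j x = (case j of
        Inl d \<Rightarrow> dnorm (p (s d) - p (t d)) (Z x (s d) - Z x (t d))
      | Inr k \<Rightarrow> if k = 0 then base (Z x v1) \<bullet> f
                else if k = 1 then base (Z x v1) \<bullet> (e \<times> f)
                else base (Z x v2) \<bullet> (e \<times> f))" for j x
  \<comment> \<open>\<open>v0\<close> is pinned by having no unknowns of its own\<close>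
  define I where "I = Sigma (V - {v0}) (\<lambda>_. UNIV :: 4 set)"
  define J where "J = edges G <+> {..<3::nat}"
  have L_lin: "L j (\<lambda>i. a * x i + b * y i) = a * L j x + b * L j y" for j a b x y
  proof (cases j)
    case (Inl d)
    interpret dnorm: bounded_linear "dnorm (p (s d) - p (t d))" by (rule dnorm_bounded_linear)
    show ?thesis
      by (simp add: L_def Inl Z_lin dnorm.add dnorm.diff dnorm.scaleR algebra_simps)
  next
    case (Inr k)
    show ?thesis
      by (simp add: L_def Inr Z_lin base.add base.scaleR inner_add_left)
  qed
  have finIJ: "finite I" "finite J" using finV finE by (auto simp: I_def J_def)
  have cardI: "card I = 4 * (card V - 1)"
    using V(1) finV by (simp add: I_def card_SigmaI)
  have cardJ: "card J = card (edges G) + 3" using finE by (simp add: J_def card_Plus)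
  have "\<not> card J < card I"
  proof
    assume "card J < card I"
    then obtain x where nz: "\<exists>i. x i \<noteq> 0" and supp: "\<And>i. i \<notin> I \<Longrightarrow> x i = 0"
      and sol: "\<And>j. j \<in> J \<Longrightarrow> L j x = 0"
      using homogeneous_system_nontrivial[of J I L] finIJ L_lin by blast
    have "dnorm (p v - p w) (Z x v - Z x w) = 0" if "{v, w} \<in> edges G" for v w
    proof -
      define d where "d = {v, w}"
      have "L (Inl d) x = 0" using that by (intro sol) (auto simp: J_def d_def)
      then have "dnorm (p (s d) - p (t d)) (Z x (s d) - Z x (t d)) = 0" by (simp add: L_def)
      moreover have "(v = s d \<and> w = t d) \<or> (v = t d \<and> w = s d)"
        using st[of d] that by (auto simp: d_def doubleton_eq_iff)
      ultimately show ?thesis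
        using dnorm_minus_minus[of "p v - p w" "Z x v - Z x w"] by auto
    qed
    then have "infinitesimal_flex G p (Z x)" by (simp add: infinitesimal_flex_iff[OF simple wp])
    then have "trivial_flex G p (Z x)" using rigid by (simp add: infinitesimally_rigid_def)
    then obtain \<eta> where "\<eta> \<in> inf_rigid_motions" and \<eta>: "\<And>v. v \<in> V \<Longrightarrow> Z x v = \<eta> (p v)"
      by (auto simp: trivial_flex_def V_def)
    from this(1) obtain \<omega> b c where m: "\<eta> = motion \<omega> b c" by (rule inf_rigid_motion_is_motion)
    have "Z x v0 = 0" using supp by (simp add: Z_0 I_def)
    then have c: "c = 0" and b: "b = - (\<omega> \<times> base (p v0))"
      using \<eta>[OF V(1)]
      by (auto simp: m motion_def eq_iff_coordinates base.zero height.zero add_eq_0_iff)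
    have Zb: "base (Z x v) = \<omega> \<times> (base (p v) - base (p v0))" if "v \<in> V" for v
      using \<eta>[OF that] by (simp add: m motion_def b Cross3.right_diff_distrib)
    have pins: "L (Inr k) x = 0" if "k < 3" for k using that by (intro sol) (auto simp: J_def)
    have "(\<omega> \<times> e) \<bullet> f = 0" using pins[of 0] by (simp add: L_def Zb V e_def)
    moreover have "(\<omega> \<times> e) \<bullet> (e \<times> f) = 0" using pins[of 1] by (simp add: L_def Zb V e_def)
    moreover have "(\<omega> \<times> f) \<bullet> (e \<times> f) = 0" using pins[of 2] by (simp add: L_def Zb V f_def)
    ultimately have "\<omega> = 0"
      using nc by (intro rotation_eq_0_if_pinned[of e f]) (simp_all add: e_def f_def)
    then have "Z x v = 0" if "v \<in> V" for v
      using \<eta>[OF that] b c by (simp add: m motion_def eq_iff_coordinates base.zero height.zero)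
    then have "x (v, k) = 0" for v k using supp by (cases "v \<in> V") (auto simp: Z_0 I_def)
    then show False using nz by auto
  qed
  then show "4 * card (verts G) \<le> card (edges G) + 7"
    using cardI cardJ card3 by (simp add: V_def)
qed

end

lemma finite_simple_complete_graph: "finite_simple_graph (complete_graph m)"
  by (auto simp: finite_simple_graph_def complete_graph_def)

lemma complete_graph_edge_iff:
  "{i, j} \<in> edges (complete_graph m) \<longleftrightarrow> i < m \<and> j < m \<and> i \<noteq> j"
  by (auto simp: complete_graph_def card_insert_if)

lemma graph_isomorphic_complete_graph:
  assumes "finite V" and "E = {e. e \<subseteq> V \<and> card e = 2}"
  shows "graph_isomorphic (V, E) (complete_graph (card V))"
proof -
  obtain f where f: "bij_betw f V {..<card V}"
    using ex_bij_betw_finite_nat[OF assms(1)] by (auto simp: atLeast0LessThan)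
  then have inj: "inj_on f V" and img: "f ` V = {..<card V}" by (auto simp: bij_betw_def)
  have "(\<lambda>e. f ` e) ` E = {e. e \<subseteq> {..<card V} \<and> card e = 2}"
  proof (intro equalityI subsetI)
    fix d assume "d \<in> (\<lambda>e. f ` e) ` E"
    then obtain e where e: "e \<subseteq> V" "card e = 2" "d = f ` e" using assms(2) by blast
    then have "card d = 2" using inj by (metis card_image inj_on_subset)
    then show "d \<in> {e. e \<subseteq> {..<card V} \<and> card e = 2}" using e img by blast
  next
    fix d assume "d \<in> {e. e \<subseteq> {..<card V} \<and> card e = 2}"
    then have d: "d \<subseteq> f ` V" "card d = 2" using img by auto
    then obtain e where e: "e \<subseteq> V" "d = f ` e" by (auto simp: subset_image_iff)
    then have "card e = 2" using d inj by (metis card_image inj_on_subset)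
    then show "d \<in> (\<lambda>e. f ` e) ` E" using e assms(2) by blast
  qed
  then show ?thesis using f by (auto simp: graph_isomorphic_def complete_graph_def)
qed

text \<open>
  With \<open>\<bar>E\<bar> \<le> n (n - 1) / 2\<close> the edge count gives \<open>4 n \<le> n (n - 1) / 2 + 7\<close>. Among
  \<open>3 \<le> n \<le> 7\<close> only \<open>n = 7\<close> satisfies this, with equality throughout.
\<close>

lemma (in hyper_cylinder) small_rigid_framework_is_K7:
  fixes G :: "'v graph" and p :: "'v \<Rightarrow> 'a"
  assumes simple: "finite_simple_graph G" and "full_framework G p"
    and "well_positioned G p" and "infinitesimally_rigid G p" and small: "card (verts G) < 8"
  shows "graph_isomorphic G (complete_graph 7)"
proof -
  define n where "n = card (verts G)"
  define K where "K = {e. e \<subseteq> verts G \<and> card e = 2}"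
  have finV: "finite (verts G)" using simple by (simp add: finite_simple_graph_def)
  have finK: "finite K" using finV by (simp add: K_def)
  have EK: "edges G \<subseteq> K" using simple by (auto simp: K_def finite_simple_graph_def)
  have cardK: "card K = n choose 2" using finV by (simp add: K_def n_def n_subsets)
  have "card (edges G) \<le> n choose 2" using card_mono[OF finK EK] cardK by simp
  then have edges: "4 * n \<le> (n choose 2) + 7" "3 \<le> n" "4 * n \<le> card (edges G) + 7" "n < 8"
    using edge_count_if_rigid[OF assms(1-4)] small by (auto simp: n_def)
  have "n \<in> {3, 4, 5, 6, 7}" using edges by auto
  then have n7: "n = 7" using edges(1) by (auto simp: choose_two)
  then have "edges G = K"
    using edges(3) cardK by (intro card_seteq[OF finK EK]) (simp add: choose_two)
  then have "G = (verts G, K)" by (simp add: prod_eq_iff)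
  then show ?thesis
    using graph_isomorphic_complete_graph[OF finV K_def] n7 by (simp add: n_def)
qed

section \<open>A rigid placement of every complete graph on at least seven vertices\<close>

text \<open>
  The bar between \<open>i\<close> and \<open>j\<close> is of vertical kind if the distance of the sites is less than
  that of the levels. Levels are \<open>0\<close> for the vertices 2, 3, 5 and \<open>5\<close> for 0, 1, 4, 6, so a
  bar among the first seven is vertical exactly if it crosses between the two classes and
  has horizontal length less than \<open>5\<close>. The vertical bars form the tree with edges 56, 50,
  51, 62, 63, 34. Its complement is the triangle 012, with 3 and 4 joined to 0, 1, 2, then 5
  joined to 2, 3, 4, and 6 joined to 0, 1, 4.

  Vertices from 7 on share one site, at levels between \<open>5\<close> and \<open>6\<close>. They are joined to each
  other and to 5 by vertical bars and to all other vertices by Euclidean ones.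
\<close>

definition site :: "nat \<Rightarrow> real^3" where
  "site i = (if i < 7
    then [vector [0, 0, 0], vector [2, 0, 0], vector [3, 8, 0], vector [-2, 8, 1],
          vector [-5, 10, 3], vector [1, 3, 1], vector [1, 6, 0]] ! i
    else vector [1, 0, 3])"

definition level :: "nat \<Rightarrow> real" where
  "level i = (if i \<in> {2, 3, 5} then 0 else if i < 7 then 5 else 5 + 1 / real i)"

lemma less_7_cases: "i < 7 \<Longrightarrow> i = 0 \<or> i = 1 \<or> i = 2 \<or> i = 3 \<or> i = 4 \<or> i = 5 \<or> i = (6::nat)"
  by linarith

lemma site_triangle_noncollinear: "(site 1 - site 0) \<times> (site 2 - site 0) \<noteq> 0"
proof -
  have "((site 1 - site 0) \<times> (site 2 - site 0)) $ 3 = 16"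
    by (simp add: site_def cross_components)
  then show ?thesis by auto
qed

lemmas inner_R3 = inner_vec_def sum_3

text \<open>
  No bar lies on the cone. For the vertices from 7 on, a level in \<open>{5<..<6}\<close> leaves enough
  room: their squared horizontal distances to the vertices at level \<open>5\<close> are at least \<open>1\<close>,
  those to the vertices at level \<open>0\<close> lie outside the range from \<open>25\<close> to \<open>36\<close>.
\<close>

lemma site_level_generic:
  assumes "i \<noteq> j"
  shows "(level i - level j)\<^sup>2 \<noteq> (site i - site j) \<bullet> (site i - site j)"
proof -
  have far: "(level i - level j)\<^sup>2 \<noteq> (site i - site j) \<bullet> (site i - site j)"
    if "i \<ge> 7" "j < 7" for i j
  proof -
    define \<epsilon> where "\<epsilon> = 1 / real i"
    have \<epsilon>: "0 < \<epsilon>" "\<epsilon> < 1" using that by (auto simp: \<epsilon>_def)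
    then have "\<epsilon>\<^sup>2 < 1\<^sup>2" "(5 + \<epsilon>)\<^sup>2 < 6\<^sup>2" "5\<^sup>2 < (5 + \<epsilon>)\<^sup>2"
      by (intro power_strict_mono; simp)+
    then have sq: "\<epsilon>\<^sup>2 < 1" "(5 + \<epsilon>)\<^sup>2 < 36" "25 < (5 + \<epsilon>)\<^sup>2" by simp_all
    have "level i = 5 + \<epsilon>" "site i = vector [1, 0, 3]" using that by (auto simp: level_def site_def \<epsilon>_def)
    then show ?thesis
      using less_7_cases[OF that(2)] sq by (auto simp: level_def site_def inner_R3)
  qed
  consider "i \<ge> 7" "j \<ge> 7" | "i \<ge> 7" "j < 7" | "i < 7" "j \<ge> 7" | "i < 7" "j < 7" by linarith
  then show ?thesis
  proof cases
    case 1
    then have "level i - level j \<noteq> 0" using assms by (auto simp: level_def)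
    then show ?thesis using 1 by (simp add: site_def)
  next
    case 2
    then show ?thesis by (rule far)
  next
    case 3
    then show ?thesis using far[of j i] by (simp add: power2_commute inner_diff_left inner_diff_right inner_commute)
  next
    case 4
    from less_7_cases[OF 4(1)] less_7_cases[OF 4(2)] show ?thesis
      using assms by (elim disjE) (simp_all add: level_def site_def inner_R3)
  qed
qed

context hyper_cylinder
begin

definition placement :: "nat \<Rightarrow> 'a" where
  "placement i = point (site i) (level i)"

lemma placement_flat_iff:
  "norm (base (placement i - placement j)) > \<bar>height (placement i - placement j)\<bar>
    \<longleftrightarrow> (level i - level j)\<^sup>2 < (site i - site j) \<bullet> (site i - site j)"
proof -
  have "(level i - level j)\<^sup>2 < (norm (site i - site j))\<^sup>2 \<longleftrightarrow> \<bar>level i - level j\<bar> < norm (site i - site j)"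
    by (metis abs_le_square_iff abs_norm_cancel linorder_not_less)
  then show ?thesis by (simp add: placement_def base.diff height.diff dot_square_norm)
qed

lemma off_cone_placement:
  assumes "i \<noteq> j"
  shows "off_cone (placement i - placement j)"
proof -
  have "(norm (site i - site j))\<^sup>2 \<noteq> \<bar>level i - level j\<bar>\<^sup>2"
    using site_level_generic[OF assms] by (simp add: dot_square_norm)
  then show ?thesis by (auto simp: off_cone_def placement_def base.diff height.diff)
qed

lemma well_positioned_placement: "well_positioned (complete_graph m) placement"
  by (auto simp: well_positioned_def norm_smooth_at_iff complete_graph_edge_iff off_cone_placement)

text \<open>
  The vertical velocities agree along the tree of vertical bars, and along the bar to vertex
  5 for the later vertices. The horizontal velocities are a rotation field on the triangle
  012, and the field propagates to 3, 4, 5, 6 and then to every later vertex, since each is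
  joined to three earlier ones by Euclidean bars in independent directions.
\<close>

lemma infinitesimally_rigid_placement:
  assumes m: "m \<ge> 7"
  shows "infinitesimally_rigid (complete_graph m) placement"
  unfolding infinitesimally_rigid_def
proof (intro allI impI)
  fix z assume "infinitesimal_flex (complete_graph m) placement z"
  then have d: "dnorm (placement i - placement j) (z i - z j) = 0" if "i < m" "j < m" "i \<noteq> j" for i j
    using that by (simp add: infinitesimal_flex_iff[OF finite_simple_complete_graph well_positioned_placement]
        complete_graph_edge_iff)
  define y where "y i = base (z i)" for i
  have flat: "(site i - site j) \<bullet> (y i - y j) = 0"
    if "i < m" "j < m" "(level i - level j)\<^sup>2 < (site i - site j) \<bullet> (site i - site j)" for i j
  proof (cases "i = j")
    case False
    from d[OF that(1,2) False] show ?thesis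
      using that(3) dnorm_eq_0_iff[OF off_cone_placement[OF False], of "z i - z j"]
      by (simp add: placement_flat_iff) (simp add: placement_def base.diff y_def)
  qed simp
  have steep: "height (z i) = height (z j)"
    if "i < m" "j < m" "(level i - level j)\<^sup>2 > (site i - site j) \<bullet> (site i - site j)" for i j
  proof (cases "i = j")
    case False
    from d[OF that(1,2) False] show ?thesis
      using that(3) dnorm_eq_0_iff[OF off_cone_placement[OF False], of "z i - z j"]
      by (simp add: placement_flat_iff) (simp add: height.diff)
  qed simp
  note concrete = level_def site_def inner_R3
  have late: "(level i)\<^sup>2 > 25" "(level i - 5)\<^sup>2 < 1" if "i \<ge> 7" for i
  proof -
    have "5\<^sup>2 < (5 + 1 / real i)\<^sup>2" "(1 / real i)\<^sup>2 < 1\<^sup>2"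
      using that by (intro power_strict_mono; simp)+
    then show "(level i)\<^sup>2 > 25" "(level i - 5)\<^sup>2 < 1" using that by (simp_all add: level_def)
  qed
  have small: "k < m" if "k \<le> 6" for k using that m by simp
  have h: "height (z i) = height (z 5)" if "i < m" for i
  proof -
    have h6: "height (z 6) = height (z 5)" and h0: "height (z 0) = height (z 5)"
      and h1: "height (z 1) = height (z 5)" and h2: "height (z 2) = height (z 6)"
      and h3: "height (z 3) = height (z 6)" and h4: "height (z 4) = height (z 3)"
      by (rule steep; simp add: small concrete)+
    show ?thesis
    proof (cases "i < 7")
      case True
      from less_7_cases[OF this] show ?thesis using h0 h1 h2 h3 h4 h6 by auto
    next
      case False
      then show ?thesis
        using that late[of i] by (intro steep) (simp_all add: small concrete)
    qed
  qed
  obtain \<omega> b where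
    y0: "y 0 = \<omega> \<times> site 0 + b" and y1: "y 1 = \<omega> \<times> site 1 + b" and y2: "y 2 = \<omega> \<times> site 2 + b"
  proof (rule rotation_field_on_triangle[of site 1 0 2 y])
    show "(site 1 - site 0) \<times> (site 2 - site 0) \<noteq> 0"
      by (rule site_triangle_noncollinear)
  qed (rule flat; simp add: small concrete)+
  note extend = rotation_field_extends[where q = site and y = y and \<omega> = \<omega> and b = b]
  have y3: "y 3 = \<omega> \<times> site 3 + b"
    by (rule extend[OF _ _ _ _ y0 y1 y2])
      ((rule flat)?; simp add: small concrete cross_components)+
  have y4: "y 4 = \<omega> \<times> site 4 + b"
    by (rule extend[OF _ _ _ _ y0 y1 y2])
      ((rule flat)?; simp add: small concrete cross_components)+
  have y5: "y 5 = \<omega> \<times> site 5 + b"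
    by (rule extend[OF _ _ _ _ y2 y3 y4])
      ((rule flat)?; simp add: small concrete cross_components)+
  have y6: "y 6 = \<omega> \<times> site 6 + b"
    by (rule extend[OF _ _ _ _ y0 y1 y4])
      ((rule flat)?; simp add: small concrete cross_components)+
  have y: "y i = \<omega> \<times> site i + b" if "i < m" for i
  proof (cases "i < 7")
    case True
    from less_7_cases[OF this] show ?thesis using y0 y1 y2 y3 y4 y5 y6 by auto
  next
    case False
    have "(site i - site j) \<bullet> (y i - y j) = 0" if "j \<in> {0, 1, 4}" for j
      using that False \<open>i < m\<close> late[of i] by (intro flat) (auto simp: small concrete)
    moreover have "((site i - site 0) \<times> (site i - site 1)) \<bullet> (site i - site 4) \<noteq> 0"
      using False by (simp add: concrete cross_components)
    ultimately show ?thesis by (intro extend[OF _ _ _ _ y0 y1 y4]) auto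
  qed
  have "z i = motion \<omega> b (height (z 5)) (placement i)" if "i < m" for i
    using y[OF that] h[OF that] by (simp add: eq_iff_coordinates motion_def placement_def y_def)
  then show "trivial_flex (complete_graph m) placement z"
    unfolding trivial_flex_def using motion_in_inf_rigid_motions
    by (auto simp: complete_graph_def intro!: bexI[of _ "motion \<omega> b (height (z 5))"])
qed

lemma rigid_placement_of_complete_graph:
  assumes "m \<ge> 7"
  shows "framework (complete_graph m) placement \<and> full_framework (complete_graph m) placement \<and>
    well_positioned (complete_graph m) placement \<and> infinitesimally_rigid (complete_graph m) placement"
proof (intro conjI)
  show "well_positioned (complete_graph m) placement" by (rule well_positioned_placement)
  have "placement i \<noteq> placement j" if "i \<noteq> j" for i j
    using off_cone_placement[OF that] by (auto simp: off_cone_def base.zero height.zero)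
  then show "framework (complete_graph m) placement"
    by (simp add: framework_def finite_simple_complete_graph complete_graph_edge_iff)
  have "(base (placement 1) - base (placement 0)) \<times> (base (placement 2) - base (placement 0)) \<noteq> 0"
    by (simp add: placement_def site_triangle_noncollinear del: One_nat_def)
  moreover have "placement i \<in> placement ` verts (complete_graph m)" if "i < 7" for i
    using that assms by (auto simp: complete_graph_def)
  ultimately show "full_framework (complete_graph m) placement"
    unfolding full_framework_def full_set_iff_noncollinear
    by (intro bexI[of _ "placement 0"] bexI[of _ "placement 1"] bexI[of _ "placement 2"]) auto
  show "infinitesimally_rigid (complete_graph m) placement"
    by (rule infinitesimally_rigid_placement[OF assms])
qed

end

unbundle set_product_syntax and no cross3_syntax

section \<open>Choice of coordinates\<close>

lemma hyper_cylinder_coordinates: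
  assumes "hyper_cylindrical TYPE('a::real_normed_vector)"
  obtains base :: "'a::real_normed_vector \<Rightarrow> real^3" and height point where "hyper_cylinder base height point"
proof -
  obtain T :: "'a \<Rightarrow> real^4" where T: "linear T" "bij T" "\<And>x. hcyl_norm (T x) = norm x"
    using assms by (auto simp: hyper_cylindrical_def)
  define base :: "'a \<Rightarrow> real^3" where "base x = vector [T x $ 1, T x $ 2, T x $ 3]" for x
  define height where "height x = T x $ 4" for x
  define point where
    "point u h = inv T (\<chi> i. if i = 1 then u $ 1 else if i = 2 then u $ 2 else if i = 3 then u $ 3 else h)"
    for u :: "real^3" and h
  have T_inv: "T (inv T w) = w" for w using T(2) by (simp add: bij_is_surj surj_f_inv_f)
  have "hyper_cylinder base height point"
  proof (rule hyper_cylinder.intro)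
    show "linear base" "linear height"
      by (auto intro!: linearI
          simp: base_def height_def vec_eq_iff forall_3 linear_add[OF T(1)] linear_scale[OF T(1)])
    show "base (point u h) = u" "height (point u h) = h" for u h
      by (simp_all add: base_def height_def point_def T_inv vec_eq_iff forall_3)
    show "norm x = max (norm (base x)) \<bar>height x\<bar>" for x
      by (simp add: T(3)[symmetric] hcyl_norm_def base_def height_def norm_vec_def L2_set_def sum_3)
    show "point (base x) (height x) = x" for x
    proof -
      have "(\<chi> i. if i = 1 then base x $ 1 else if i = 2 then base x $ 2
          else if i = 3 then base x $ 3 else height x) = T x"
        by (simp add: vec_eq_iff forall_4 base_def height_def)
      then show ?thesis using T(2) by (simp add: point_def bij_is_inj)
    qed
  qed
  then show ?thesis by (rule that)
qed

theorem theorem5p10: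
  assumes "hyper_cylindrical TYPE('a::real_normed_vector)"
  shows "(\<forall>(G :: 'v graph) (p :: 'v \<Rightarrow> 'a).
            framework G p \<and> full_framework G p \<and> well_positioned G p \<and>
            infinitesimally_rigid G p \<longrightarrow>
            graph_isomorphic G (complete_graph 7) \<or> card (verts G) \<ge> 8) \<and>
         (\<forall>m\<ge>7. \<exists>p :: nat \<Rightarrow> 'a.
            framework (complete_graph m) p \<and> full_framework (complete_graph m) p \<and>
            well_positioned (complete_graph m) p \<and> infinitesimally_rigid (complete_graph m) p)"
proof -
  obtain base :: "'a \<Rightarrow> real^3" and height point where "hyper_cylinder base height point"
    using assms by (rule hyper_cylinder_coordinates)
  then interpret hyper_cylinder base height point .
  show ?thesis
    using small_rigid_framework_is_K7 rigid_placement_of_complete_graph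
    by (meson framework_def linorder_not_less)
qed

end
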